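(* Let $\{(x_t,y_t,z_t)\}_{t\ge0}$ be the sequence generated by the Meta-ISAD algorithm described in the context with the General APO described in the context as penalty oracle, and let $\{\beta_t\}_{t\ge0}$ be the generated sequence of adaptive penalties. Then $\{(x_t,y_t,z_t,\beta_t)\}_{t\ge0}$ satisfies the APO requirements: the $\beta_t$ are positive and, almost surely, there is an index $K_{stable}>0$ such that 1. $\beta_k=\beta_{K_{stable}}$ for all $k>K_{stable}$; 2. there exists $\rho>0$ such that for all $k>K_{stable}$, $$g^{k+1}(x_{k+1})-g^{k+1}(x_k)\le-\frac{\rho}{2}\|x_{k+1}-x_k\|^2$$ and $$\rho>\frac{8}{\beta_k\sigma}\Big(\big(L^e_{\nabla h+\nabla\phi}(\{x_t\}_{t\ge0})\big)^2+\big(L^e_{\nabla\phi}(\{x_t\}_{t\ge0})\big)^2\Big).$$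
   Context: **Problem.** $\min_{x\in\mathbb R^n}h(x)+P(\mathbb E[M]x)$, where $h:\mathbb R^n\to\mathbb R$ is twice continuously differentiable; $P:\mathbb R^n\to\mathbb R\cup\{\infty\}$ is proper, lower semicontinuous and prox-tractable: for all $u\in\mathbb R^n$, $\mu>0$, the set $\operatorname{argmin}_{v}\{P(v)+\frac1{2\mu}\|v-u\|^2\}$ is nonempty (and an element is efficiently computable). $M\in\mathbb R^{n\times n}$ is a random matrix with distribution $\pi$, entrywise expectation $\mathbb E[M]$ and finite entrywise variance; $\mathbb E[M]$ has full rank, so $\sigma:=\lambda_{\min}(\mathbb E[M]^T\mathbb E[M])>0$. The sampled matrices $M^1,M^2,\dots$ are i.i.d. with distribution $\pi$. Norms are $\ell_2$ (for matrices, the induced $\ell_2$ norm). **Sampling regime.** Fix an arbitrary $\epsilon_s>0$. If all entries of the sampled matrices are sub-Gaussian (a random variable $X$ is sub-Gaussian if $\mathbb E[\exp(X^2/K)]\le 2$ for some $K>0$), then $\theta_t=\lceil t^{1+\epsilon_s}\rceil$; otherwise $\theta_t=\lceil t^{2+\epsilon_s}\rceil$. **Meta-ISAD algorithm.** Input: $x_0,z_0\in\mathbb R^n$ ($y_0$ arbitrary), $\beta_0>0$, $\{\theta_t\}$, and a convex $\phi\in C^2(\mathbb R^n)$, with $D_\phi(x,x')=\phi(x)-\phi(x')-\langle\nabla\phi(x'),x-x'\rangle$. For $t=0,1,2,\dots$: sample $M^{\theta_t+1},\dots,M^{\theta_{t+1}}$ and set $\bar M^{t+1}=\frac{1}{\theta_{t+1}}\sum_{i=1}^{\theta_{t+1}}M^i$;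 then - $y_{t+1}\in\operatorname{argmin}_y\{P(y)+\langle z_t,y\rangle+\frac{\beta_t}{2}\|\bar M^{t+1}x_t-y\|^2\}$; - $x_{t+1}$ is a critical point (zero gradient) of $g^{t+1}(x):=h(x)-\langle z_t,\bar M^{t+1}x\rangle+\frac{\beta_t}{2}\|\bar M^{t+1}x-y_{t+1}\|^2+D_\phi(x,x_t)$; - $z_{t+1}=z_t-\beta_t(\bar M^{t+1}x_{t+1}-y_{t+1})$; - $\beta_{t+1}$ is the output of a penalty oracle. The generated sequence $\{(x_t,y_t,z_t)\}_{t>0}$ is assumed to be bounded (standing assumption). **General APO.** Parameter $\epsilon>0$; it maintains $\zeta_t,\xi_t$ with $\zeta_0=\xi_0=0$. At iteration $t$: - If $x_{t+1}=x_t$: $\beta_{t+1}=\beta_t$, $\zeta_{t+1}=\zeta_t$, $\xi_{t+1}=\xi_t$. - Otherwise set $\zeta_{t+1}=\max\Big\{\zeta_t,\frac{\|\nabla h(x_{t+1})+\nabla\phi(x_{t+1})-\nabla h(x_t)-\nabla\phi(x_t)\|^2}{\|x_{t+1}-x_t\|^2}\Big\}$, $\xi_{t+1}=\max\Big\{\xi_t,\frac{\|\nabla\phi(x_{t+1})-\nabla\phi(x_t)\|^2}{\|x_{t+1}-x_t\|^2}\Big\}$, and $\tilde\sigma=\lambda_{\min}((\bar M^{t+1})^T\bar M^{t+1})$. If $\tilde\sigma=0$, set $\beta_{t+1}=\beta_t$. If $\tilde\sigma\neq0$, set $\rho_t=-\frac{2(g^{t+1}(x_{t+1})-g^{t+1}(x_t))}{\|x_{t+1}-x_t\|^2}$;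 if $\frac14\rho_t>\frac{8(\zeta_{t+1}+\xi_{t+1}+\epsilon)}{\beta_t\tilde\sigma}$ set $\beta_{t+1}=\beta_t$, else set $\beta_{t+1}=2\beta_t$. **Empirical Lipschitz constant.** For $F:\mathbb R^k\to\mathbb R^l$ and a sequence $\{x_t\}_{t\ge0}$, $L^e_F(\{x_t\}_{t\ge0})=\sup_{t\ge0,\,x_{t+1}\ne x_t}\frac{\|F(x_{t+1})-F(x_t)\|}{\|x_{t+1}-x_t\|}$, and it equals $0$ if $x_{t+1}=x_t$ for all $t$. *)

theory Defs
  imports "HOL-Analysis.Analysis" "HOL-Probability.Probability"
begin

subsection \<open>Smooth and extended-valued functions\<close>

definition grad :: "('a::real_inner \<Rightarrow> real) \<Rightarrow> 'a \<Rightarrow> 'a" where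
  "grad f x = (THE D. GDERIV f x :> D)"

definition twice_cont_diff :: "(real^'n \<Rightarrow> real) \<Rightarrow> bool" where
  "twice_cont_diff f \<longleftrightarrow>
     (\<forall>x. f differentiable (at x)) \<and>
     (\<exists>H :: real^'n \<Rightarrow> real^'n^'n.
        continuous_on UNIV H \<and> (\<forall>x. (grad f has_derivative (\<lambda>v. H x *v v)) (at x)))"

definition bregman :: "('a::real_inner \<Rightarrow> real) \<Rightarrow> 'a \<Rightarrow> 'a \<Rightarrow> real" where
  "bregman \<phi> u v = \<phi> u - \<phi> v - grad \<phi> v \<bullet> (u - v)"

text \<open>A function into the reals extended by infinity is an \<^typ>\<open>ereal\<close>-valued function avoiding
  minus infinity.\<close>

definition proper :: "('a \<Rightarrow> ereal) \<Rightarrow> bool" where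
  "proper f \<longleftrightarrow> (\<forall>v. f v \<noteq> -\<infinity>) \<and> (\<exists>v. f v \<noteq> \<infinity>)"

definition lower_semicont :: "('a::topological_space \<Rightarrow> ereal) \<Rightarrow> bool" where
  "lower_semicont f \<longleftrightarrow> (\<forall>v. f v \<le> Liminf (at v) f)"

definition prox_tractable :: "('a::real_normed_vector \<Rightarrow> ereal) \<Rightarrow> bool" where
  "prox_tractable f \<longleftrightarrow>
     (\<forall>u. \<forall>\<mu>>0. {v. is_arg_min (\<lambda>v. f v + ereal (1 / (2 * \<mu>) * (norm (v - u))\<^sup>2)) (\<lambda>_. True) v} \<noteq> {})"

text \<open>Smallest eigenvalue; meaningful for symmetric matrices only.\<close>

definition lambda_min :: "real^'n^'n \<Rightarrow> real" where
  "lambda_min A = (LEAST c. \<exists>v. v \<noteq> 0 \<and> A *v v = c *\<^sub>R v)"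

text \<open>The supremum is taken in \<^typ>\<open>ereal\<close>, so that it is meaningful also when the difference
  quotients are unbounded. The empty supremum would be minus infinity there, whence the case
  distinction.\<close>

definition emp_lipschitz ::
    "('a::real_normed_vector \<Rightarrow> 'b::real_normed_vector) \<Rightarrow> (nat \<Rightarrow> 'a) \<Rightarrow> ereal" where
  "emp_lipschitz F x =
     (if \<forall>t. x (Suc t) = x t then 0
      else (SUP t\<in>{t. x (Suc t) \<noteq> x t}.
              ereal (norm (F (x (Suc t)) - F (x t)) / norm (x (Suc t) - x t))))"

subsection \<open>Random matrices and sampling\<close>

definition mean_matrix :: "(real^'n^'n) measure \<Rightarrow> real^'n^'n" where
  "mean_matrix \<pi> = (\<chi> i j. \<integral>A. A $ i $ j \<partial>\<pi>)"

definition finite_mean_variance :: "(real^'n^'n) measure \<Rightarrow> bool" where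
  "finite_mean_variance \<pi> \<longleftrightarrow>
     (\<forall>i j. integrable \<pi> (\<lambda>A. A $ i $ j) \<and>
            integrable \<pi> (\<lambda>A. (A $ i $ j - mean_matrix \<pi> $ i $ j)\<^sup>2))"

definition subgaussian :: "'w measure \<Rightarrow> ('w \<Rightarrow> real) \<Rightarrow> bool" where
  "subgaussian N X \<longleftrightarrow>
     X \<in> borel_measurable N \<and> (\<exists>K>0. (\<integral>\<^sup>+\<omega>. ennreal (exp ((X \<omega>)\<^sup>2 / K)) \<partial>N) \<le> 2)"

definition sample_size :: "real \<Rightarrow> (real^'n^'n) measure \<Rightarrow> nat \<Rightarrow> nat" where
  "sample_size \<epsilon>s \<pi> t =
     (if \<forall>i j. subgaussian \<pi> (\<lambda>A. A $ i $ j)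
      then nat \<lceil>real t powr (1 + \<epsilon>s)\<rceil> else nat \<lceil>real t powr (2 + \<epsilon>s)\<rceil>)"

definition sample_mean :: "(nat \<Rightarrow> real^'n^'n) \<Rightarrow> nat \<Rightarrow> real^'n^'n" where
  "sample_mean M k = (1 / real k) *\<^sub>R (\<Sum>i=1..k. M i)"

subsection \<open>The algorithm and the penalty oracle\<close>

definition isad_obj ::
    "(real^'n \<Rightarrow> real) \<Rightarrow> (real^'n \<Rightarrow> real) \<Rightarrow> real^'n^'n \<Rightarrow> real \<Rightarrow>
     real^'n \<Rightarrow> real^'n \<Rightarrow> real^'n \<Rightarrow> real^'n \<Rightarrow> real" where
  "isad_obj h \<phi> A b xt ynext zt u =
     h u - zt \<bullet> (A *v u) + b / 2 * (norm (A *v u - ynext))\<^sup>2 + bregman \<phi> u xt"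

text \<open>The predicates below describe single sample paths; \<open>A t\<close> is the sample average with index
  \<open>t\<close>, so iteration \<open>t\<close> uses \<open>A (Suc t)\<close>, and \<open>isad_g \<dots> t\<close> is the objective with index \<open>t + 1\<close>.\<close>

definition isad_g ::
    "(real^'n \<Rightarrow> real) \<Rightarrow> (real^'n \<Rightarrow> real) \<Rightarrow> (nat \<Rightarrow> real^'n^'n) \<Rightarrow>
     (nat \<Rightarrow> real^'n) \<Rightarrow> (nat \<Rightarrow> real^'n) \<Rightarrow> (nat \<Rightarrow> real^'n) \<Rightarrow> (nat \<Rightarrow> real) \<Rightarrow>
     nat \<Rightarrow> real^'n \<Rightarrow> real" where
  "isad_g h \<phi> A x y z \<beta> t = isad_obj h \<phi> (A (Suc t)) (\<beta> t) (x t) (y (Suc t)) (z t)"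

definition meta_isad ::
    "(real^'n \<Rightarrow> real) \<Rightarrow> (real^'n \<Rightarrow> ereal) \<Rightarrow> (real^'n \<Rightarrow> real) \<Rightarrow> (nat \<Rightarrow> real^'n^'n) \<Rightarrow>
     real^'n \<Rightarrow> real^'n \<Rightarrow> real \<Rightarrow>
     (nat \<Rightarrow> real^'n) \<Rightarrow> (nat \<Rightarrow> real^'n) \<Rightarrow> (nat \<Rightarrow> real^'n) \<Rightarrow> (nat \<Rightarrow> real) \<Rightarrow> bool" where
  "meta_isad h P \<phi> A x0 z0 \<beta>0 x y z \<beta> \<longleftrightarrow>
     x 0 = x0 \<and> z 0 = z0 \<and> \<beta> 0 = \<beta>0 \<and>
     (\<forall>t. is_arg_min
            (\<lambda>v. P v + ereal (z t \<bullet> v + \<beta> t / 2 * (norm (A (Suc t) *v x t - v))\<^sup>2))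
            (\<lambda>_. True) (y (Suc t)) \<and>
          GDERIV (isad_g h \<phi> A x y z \<beta> t) (x (Suc t)) :> 0 \<and>
          z (Suc t) = z t - \<beta> t *\<^sub>R (A (Suc t) *v x (Suc t) - y (Suc t)))"

definition general_apo ::
    "real \<Rightarrow> (real^'n \<Rightarrow> real) \<Rightarrow> (real^'n \<Rightarrow> real) \<Rightarrow> (nat \<Rightarrow> real^'n^'n) \<Rightarrow>
     (nat \<Rightarrow> real^'n) \<Rightarrow> (nat \<Rightarrow> real^'n) \<Rightarrow> (nat \<Rightarrow> real^'n) \<Rightarrow> (nat \<Rightarrow> real) \<Rightarrow>
     (nat \<Rightarrow> real) \<Rightarrow> (nat \<Rightarrow> real) \<Rightarrow> bool" where
  "general_apo \<epsilon> h \<phi> A x y z \<beta> \<zeta> \<xi> \<longleftrightarrow>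
     \<zeta> 0 = 0 \<and> \<xi> 0 = 0 \<and>
     (\<forall>t. if x (Suc t) = x t
          then \<beta> (Suc t) = \<beta> t \<and> \<zeta> (Suc t) = \<zeta> t \<and> \<xi> (Suc t) = \<xi> t
          else
            \<zeta> (Suc t) = max (\<zeta> t)
              ((norm (grad h (x (Suc t)) + grad \<phi> (x (Suc t)) - grad h (x t) - grad \<phi> (x t)))\<^sup>2
               / (norm (x (Suc t) - x t))\<^sup>2) \<and>
            \<xi> (Suc t) = max (\<xi> t)
              ((norm (grad \<phi> (x (Suc t)) - grad \<phi> (x t)))\<^sup>2 / (norm (x (Suc t) - x t))\<^sup>2) \<and>
            (let \<sigma>t = lambda_min (transpose (A (Suc t)) ** A (Suc t));
                 g = isad_g h \<phi> A x y z \<beta> t;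
                 \<rho>t = - (2 * (g (x (Suc t)) - g (x t)) / (norm (x (Suc t) - x t))\<^sup>2)
             in \<beta> (Suc t) =
                  (if \<sigma>t = 0 then \<beta> t
                   else if 1 / 4 * \<rho>t > 8 * (\<zeta> (Suc t) + \<xi> (Suc t) + \<epsilon>) / (\<beta> t * \<sigma>t) then \<beta> t
                   else 2 * \<beta> t)))"

end

theory Submission
  imports Defs
begin

text \<open>Why the penalties stabilise. Almost surely the sample averages converge to the mean matrix
  \<open>B\<close>, hence \<open>\<lambda>\<^sub>t\<close>, the smallest eigenvalue of the Gram matrix of the average used at iteration \<open>t\<close>,
  converges to \<open>\<sigma> > 0\<close> (lemmas \<open>AE_tendsto_sample_mean\<close> and \<open>tendsto_lambda_min_gram\<close>).
  The rest of the argument takes place on a single sample path on which this convergence holds and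
  the iterates are bounded (lemma \<open>apo_eventually_stable\<close>).

  On a bounded set the gradients of \<open>h\<close> and \<open>\<phi>\<close> are Lipschitz, so \<open>\<zeta>\<^sub>t\<close> and \<open>\<xi>\<^sub>t\<close> are bounded. Moreover
  \<open>g\<close> is quadratic up to \<open>h\<close> and \<open>\<phi>\<close>: expanding it around the critical point \<open>x\<^sub>t\<^sub>+\<^sub>1\<close> gives, with \<open>L\<close> the
  sum of the Lipschitz constants,
  \<open>g(x\<^sub>t) - g(x\<^sub>t\<^sub>+\<^sub>1) \<ge> (\<beta>\<^sub>t \<lambda>\<^sub>t / 2 - L) \<bar>x\<^sub>t\<^sub>+\<^sub>1 - x\<^sub>t\<bar>\<^sup>2\<close>,
  that is, \<open>\<rho>\<^sub>t \<ge> \<beta>\<^sub>t \<lambda>\<^sub>t - 2 L\<close>. Once \<open>\<lambda>\<^sub>t > \<sigma> / 2\<close>, a large \<open>\<beta>\<^sub>t\<close> makes this exceed any constant while the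
  right-hand side of the test of the oracle becomes small, so the test succeeds and \<open>\<beta>\<^sub>t\<close> is kept. A
  sequence that starts at a positive value, is only ever kept or doubled, and is kept when large is
  eventually constant (lemma \<open>doubling_eventually_const\<close>).

  From then on every nontrivial step has passed the test. Its threshold uses \<open>\<zeta>\<^sub>t\<^sub>+\<^sub>1\<close>, \<open>\<xi>\<^sub>t\<^sub>+\<^sub>1\<close> and \<open>\<lambda>\<^sub>t\<close>
  where the claim has the empirical Lipschitz constants and \<open>\<sigma>\<close>. The squares of these constants are
  dominated by the limits of \<open>\<zeta>\<^sub>t\<close> and \<open>\<xi>\<^sub>t\<close>, and thanks to the margin \<open>\<epsilon>\<close> in the test the sum
  \<open>\<zeta>\<^sub>t\<^sub>+\<^sub>1 + \<xi>\<^sub>t\<^sub>+\<^sub>1 + \<epsilon>\<close> exceeds the sum of these limits after finitely many steps. Finally \<open>\<lambda>\<^sub>t < 2 \<sigma>\<close> costs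
  a factor two, which the factor \<open>1/4\<close> in the test absorbs.\<close>

section \<open>Smallest eigenvalue of a Gram matrix\<close>

text \<open>First-order optimality: the nonnegative form \<open>w \<bullet> B w - c (w \<bullet> w)\<close> vanishes at \<open>v\<close>, so it is
  stationary there, and its gradient is twice \<open>B v - c v\<close>.\<close>

lemma symmetric_eigenvector_of_minimum:
  fixes B :: "real^'n^'n"
  assumes sym: "\<And>u w. (B *v u) \<bullet> w = u \<bullet> (B *v w)"
    and ge: "\<And>w. c * (w \<bullet> w) \<le> w \<bullet> (B *v w)"
    and eq: "v \<bullet> (B *v v) = c * (v \<bullet> v)"
  shows "B *v v = c *\<^sub>R v"
proof -
  define w where "w = B *v v - c *\<^sub>R v"
  define q where "q = w \<bullet> (B *v w) - c * (w \<bullet> w)"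
  have poly: "0 \<le> 2 * s * (w \<bullet> w) + s\<^sup>2 * q" for s
  proof -
    have "B *v (v + s *\<^sub>R w) = B *v v + s *\<^sub>R (B *v w)"
      by (simp add: matrix_vector_right_distrib matrix_vector_mult_scaleR)
    moreover have "v \<bullet> (B *v w) = w \<bullet> (B *v v)"
      using sym[of v w] by (simp add: inner_commute)
    moreover have ww: "w \<bullet> (B *v v) = w \<bullet> w + c * (w \<bullet> v)"
      by (simp add: w_def inner_diff_right)
    ultimately have "(v + s *\<^sub>R w) \<bullet> (B *v (v + s *\<^sub>R w))
        - c * ((v + s *\<^sub>R w) \<bullet> (v + s *\<^sub>R w))
      = c * (v \<bullet> v) + 2 * s * (w \<bullet> w + c * (w \<bullet> v)) + s\<^sup>2 * (w \<bullet> (B *v w))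
        - c * (v \<bullet> v + 2 * s * (w \<bullet> v) + s\<^sup>2 * (w \<bullet> w))"
      by (simp add: eq inner_add_left inner_add_right inner_commute[of v w] power2_eq_square algebra_simps)
    also have "\<dots> = 2 * s * (w \<bullet> w) + s\<^sup>2 * q"
      by (simp add: q_def algebra_simps)
    finally have "(v + s *\<^sub>R w) \<bullet> (B *v (v + s *\<^sub>R w))
        - c * ((v + s *\<^sub>R w) \<bullet> (v + s *\<^sub>R w)) = 2 * s * (w \<bullet> w) + s\<^sup>2 * q" .
    with ge[of "v + s *\<^sub>R w"] show ?thesis by linarith
  qed
  have "w \<bullet> w = 0"
  proof (rule ccontr)
    assume "w \<bullet> w \<noteq> 0"
    then have pos: "w \<bullet> w > 0" by simp
    \<comment> \<open>A negative step so small that the linear term of \<open>poly\<close> dominates the quadratic one.\<close>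
    define s where "s = - (w \<bullet> w) / (\<bar>q\<bar> + w \<bullet> w)"
    have "s < 0" using pos by (simp add: s_def field_simps add_nonneg_pos)
    have "2 * (w \<bullet> w) + s * q > 0"
    proof -
      have "\<bar>s * q\<bar> \<le> \<bar>s\<bar> * (\<bar>q\<bar> + w \<bullet> w)"
        using pos by (simp add: abs_mult mult_left_mono)
      also have "\<dots> = w \<bullet> w"
      proof -
        have "0 < \<bar>q\<bar> + w \<bullet> w" using pos by linarith
        then show ?thesis using pos by (simp add: s_def abs_div_pos)
      qed
      finally have "\<bar>s * q\<bar> \<le> w \<bullet> w" .
      then show ?thesis using pos by linarith
    qed
    then have "s * (2 * (w \<bullet> w) + s * q) < 0"
      using \<open>s < 0\<close> by (simp add: mult_neg_pos)
    with poly[of s] show False by (simp add: algebra_simps power2_eq_square)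
  qed
  then show ?thesis by (simp add: w_def)
qed

text \<open>The Rayleigh quotient of the Gram matrix at a unit vector \<open>w\<close> is the square of the norm of
  \<open>A w\<close>. Its minimum over the sphere exists by compactness and is an eigenvalue; this also shows that
  the \<open>LEAST\<close> in the definition of \<^const>\<open>lambda_min\<close> ranges over a set that has a least element.\<close>

lemma lambda_min_gram_obtain:
  fixes A :: "real^'n^'n"
  obtains v where "norm v = 1"
    and "lambda_min (transpose A ** A) = (norm (A *v v))\<^sup>2"
    and "\<And>w. lambda_min (transpose A ** A) * (norm w)\<^sup>2 \<le> (norm (A *v w))\<^sup>2"
proof -
  let ?B = "transpose A ** A"
  have gram: "u \<bullet> (?B *v w) = (A *v u) \<bullet> (A *v w)" for u w
  proof -
    have "?B *v w = (A *v w) v* A"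
      by (simp add: matrix_vector_mul_assoc[symmetric])
    then show ?thesis by (metis dot_lmul_matrix inner_commute)
  qed
  have "compact (sphere 0 1 :: (real^'n) set)" by simp
  moreover have "sphere 0 1 \<noteq> ({} :: (real^'n) set)" by simp
  moreover have "continuous_on (sphere 0 1) (\<lambda>v. norm (A *v v))"
    by (intro continuous_intros linear_continuous_on matrix_vector_mul_bounded_linear)
  ultimately obtain v where v: "v \<in> sphere 0 1"
    and min: "\<And>w. w \<in> sphere 0 1 \<Longrightarrow> norm (A *v v) \<le> norm (A *v w)"
    by (metis continuous_attains_inf)
  define c where "c = (norm (A *v v))\<^sup>2"
  have ge: "c * (norm w)\<^sup>2 \<le> (norm (A *v w))\<^sup>2" for w
  proof (cases "w = 0")
    case False
    have "norm (A *v v) \<le> norm (A *v ((1 / norm w) *\<^sub>R w))"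
      using False by (intro min) simp
    then have "norm (A *v v) * norm w \<le> norm (A *v w)"
      using False by (simp add: matrix_vector_mult_scaleR field_simps)
    from power_mono[OF this, of 2] show ?thesis
      by (simp add: c_def power_mult_distrib)
  qed simp
  have "lambda_min ?B = c"
    unfolding lambda_min_def
  proof (rule Least_equality)
    have "?B *v v = c *\<^sub>R v"
    proof (rule symmetric_eigenvector_of_minimum)
      show "(?B *v u) \<bullet> w = u \<bullet> (?B *v w)" for u w
        using gram[of w u] gram[of u w] by (metis inner_commute)
      show "c * (w \<bullet> w) \<le> w \<bullet> (?B *v w)" for w
        using ge[of w] by (simp add: gram power2_norm_eq_inner)
      show "v \<bullet> (?B *v v) = c * (v \<bullet> v)"
        using v by (simp add: gram c_def power2_norm_eq_inner norm_eq_1)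
    qed
    moreover have "v \<noteq> 0" using v by auto
    ultimately show "\<exists>v. v \<noteq> 0 \<and> ?B *v v = c *\<^sub>R v" by blast
  next
    fix a assume "\<exists>u. u \<noteq> 0 \<and> ?B *v u = a *\<^sub>R u"
    then obtain u where u: "u \<noteq> 0" "?B *v u = a *\<^sub>R u" by blast
    then have "(norm (A *v u))\<^sup>2 = a * (norm u)\<^sup>2"
      using gram[of u u] by (simp add: power2_norm_eq_inner)
    with ge[of u] u(1) show "c \<le> a" by simp
  qed
  with that[of v] v ge show ?thesis by (simp add: c_def)
qed

lemma lambda_min_gram_nonneg: "0 \<le> lambda_min (transpose A ** (A :: real^'n^'n))"
  by (metis lambda_min_gram_obtain zero_le_power2)

lemma lambda_min_gram_pos:
  fixes A :: "real^'n^'n"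
  assumes "inj ((*v) A)"
  shows "0 < lambda_min (transpose A ** A)"
proof -
  obtain v where v: "norm v = 1" "lambda_min (transpose A ** A) = (norm (A *v v))\<^sup>2"
    by (metis lambda_min_gram_obtain)
  have "A *v v \<noteq> 0"
    using injD[OF assms, of v 0] v(1) by auto
  with v(2) show ?thesis by simp
qed

text \<open>The square root is the smallest singular value, an infimum of the functions mapping \<open>A\<close> to the
  norm of \<open>A w\<close>, each of which is \<open>1\<close>-Lipschitz in the operator norm.\<close>

lemma sqrt_lambda_min_gram_le:
  fixes A B :: "real^'n^'n"
  shows "sqrt (lambda_min (transpose A ** A))
    \<le> sqrt (lambda_min (transpose B ** B)) + onorm ((*v) (A - B))"
proof -
  obtain v where v: "norm v = 1" "lambda_min (transpose B ** B) = (norm (B *v v))\<^sup>2"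
    by (metis lambda_min_gram_obtain)
  have "lambda_min (transpose A ** A) * (norm v)\<^sup>2 \<le> (norm (A *v v))\<^sup>2"
    by (metis lambda_min_gram_obtain)
  then have "sqrt (lambda_min (transpose A ** A)) \<le> norm (A *v v)"
    using v(1) by (simp add: real_le_lsqrt)
  also have "A *v v = B *v v + (A - B) *v v"
    by (simp add: matrix_vector_mult_diff_rdistrib)
  also have "norm \<dots> \<le> norm (B *v v) + norm ((A - B) *v v)"
    by (rule norm_triangle_ineq)
  also have "norm ((A - B) *v v) \<le> onorm ((*v) (A - B))"
    using onorm[OF matrix_vector_mul_bounded_linear[of "A - B"], of v] v(1) by simp
  finally show ?thesis using v(2) by simp
qed

lemma tendsto_lambda_min_gram:
  fixes A :: "'a \<Rightarrow> real^'n^'n"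
  assumes "\<And>i j. ((\<lambda>t. A t $ i $ j) \<longlongrightarrow> B $ i $ j) F"
  shows "((\<lambda>t. lambda_min (transpose (A t) ** A t)) \<longlongrightarrow> lambda_min (transpose B ** B)) F"
proof -
  let ?s = "\<lambda>C :: real^'n^'n. sqrt (lambda_min (transpose C ** C))"
  have bound: "norm (?s (A t) - ?s B) \<le> (\<Sum>i\<in>UNIV. \<Sum>j\<in>UNIV. \<bar>A t $ i $ j - B $ i $ j\<bar>)" for t
  proof -
    have "onorm ((*v) (A t - B)) \<le> (\<Sum>i\<in>UNIV. \<Sum>j\<in>UNIV. \<bar>A t $ i $ j - B $ i $ j\<bar>)"
      using onorm_le_matrix_component_sum[of "A t - B"] by simp
    moreover have "onorm ((*v) (B - A t)) \<le> (\<Sum>i\<in>UNIV. \<Sum>j\<in>UNIV. \<bar>A t $ i $ j - B $ i $ j\<bar>)"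
      using onorm_le_matrix_component_sum[of "B - A t"] by (simp add: abs_minus_commute)
    ultimately show ?thesis
      using sqrt_lambda_min_gram_le[of "A t" B] sqrt_lambda_min_gram_le[of B "A t"]
      by (simp add: abs_le_iff)
  qed
  have "((\<lambda>t. \<Sum>i\<in>UNIV. \<Sum>j\<in>UNIV. \<bar>A t $ i $ j - B $ i $ j\<bar>) \<longlongrightarrow> 0) F"
  proof (intro tendsto_null_sum)
    fix i j
    show "((\<lambda>t. \<bar>A t $ i $ j - B $ i $ j\<bar>) \<longlongrightarrow> 0) F"
      using assms[of i j] by (simp add: LIM_zero_iff tendsto_rabs_zero)
  qed
  then have "((\<lambda>t. ?s (A t) - ?s B) \<longlongrightarrow> 0) F"
    by (rule Lim_null_comparison[rotated]) (intro always_eventually allI bound)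
  then have "((\<lambda>t. ?s (A t)) \<longlongrightarrow> ?s B) F"
    by (simp add: LIM_zero_iff)
  from tendsto_power[OF this, of 2] show ?thesis
    by (simp add: lambda_min_gram_nonneg)
qed

section \<open>Almost sure convergence of the sample averages\<close>

lemma (in prob_space) second_moment_sum_indep:
  fixes X :: "'i \<Rightarrow> 'a \<Rightarrow> real"
  assumes "finite I" and "indep_vars (\<lambda>_. borel) X I"
    and "\<And>i. i \<in> I \<Longrightarrow> integrable M (X i)"
    and "\<And>i. i \<in> I \<Longrightarrow> integrable M (\<lambda>\<omega>. (X i \<omega>)\<^sup>2)"
    and "\<And>i. i \<in> I \<Longrightarrow> expectation (X i) = 0"
  shows "integrable M (\<lambda>\<omega>. (\<Sum>i\<in>I. X i \<omega>)\<^sup>2) \<and>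
    expectation (\<lambda>\<omega>. (\<Sum>i\<in>I. X i \<omega>)\<^sup>2) = (\<Sum>i\<in>I. expectation (\<lambda>\<omega>. (X i \<omega>)\<^sup>2))"
  using assms
proof (induction I rule: finite_induct)
  case (insert k I)
  let ?S = "\<lambda>\<omega>. \<Sum>i\<in>I. X i \<omega>"
  have "indep_vars (\<lambda>_. borel) X I"
    using insert.prems(1) by (rule indep_vars_subset) auto
  then have IH: "integrable M (\<lambda>\<omega>. (?S \<omega>)\<^sup>2)"
      "expectation (\<lambda>\<omega>. (?S \<omega>)\<^sup>2) = (\<Sum>i\<in>I. expectation (\<lambda>\<omega>. (X i \<omega>)\<^sup>2))"
    using insert.IH insert.prems by auto
  have indep: "indep_var borel (X k) borel ?S"
    using insert.hyps insert.prems(1) by (rule indep_vars_sum)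
  have S: "integrable M ?S" using insert.prems(2) by (intro Bochner_Integration.integrable_sum) auto
  have k: "integrable M (X k)" "integrable M (\<lambda>\<omega>. (X k \<omega>)\<^sup>2)" "expectation (X k) = 0"
    using insert.prems by auto
  have cross: "integrable M (\<lambda>\<omega>. X k \<omega> * ?S \<omega>)" "expectation (\<lambda>\<omega>. X k \<omega> * ?S \<omega>) = 0"
    using indep_var_integrable[OF indep k(1) S] indep_var_lebesgue_integral[OF indep k(1) S] k(3)
    by simp_all
  have expand: "(\<lambda>\<omega>. (\<Sum>i\<in>insert k I. X i \<omega>)\<^sup>2)
      = (\<lambda>\<omega>. (X k \<omega>)\<^sup>2 + (?S \<omega>)\<^sup>2 + 2 * (X k \<omega> * ?S \<omega>))"
    using insert.hyps by (simp add: fun_eq_iff power2_sum)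
  show ?case
    unfolding expand using insert.hyps k(2) IH cross by simp
qed simp

text \<open>Summability of the moments makes the series of the squares integrable, hence almost surely
  convergent, so that its terms tend to \<open>0\<close>.\<close>

lemma (in prob_space) AE_tendsto_0_if_summable_second_moments:
  fixes Y :: "nat \<Rightarrow> 'a \<Rightarrow> real"
  assumes int: "\<And>t. integrable M (\<lambda>\<omega>. (Y t \<omega>)\<^sup>2)"
    and sm: "summable (\<lambda>t. expectation (\<lambda>\<omega>. (Y t \<omega>)\<^sup>2))"
  shows "AE \<omega> in M. (\<lambda>t. Y t \<omega>) \<longlonglongrightarrow> 0"
proof -
  have [measurable]: "(\<lambda>\<omega>. (Y t \<omega>)\<^sup>2) \<in> borel_measurable M" for t
    using int by auto
  have "(\<integral>\<^sup>+\<omega>. (\<Sum>t. ennreal ((Y t \<omega>)\<^sup>2)) \<partial>M) = (\<Sum>t. \<integral>\<^sup>+\<omega>. ennreal ((Y t \<omega>)\<^sup>2) \<partial>M)"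
    by (rule nn_integral_suminf) simp
  also have "\<dots> = (\<Sum>t. ennreal (expectation (\<lambda>\<omega>. (Y t \<omega>)\<^sup>2)))"
    using int by (simp add: nn_integral_eq_integral)
  also have "\<dots> \<noteq> \<infinity>"
    using sm by (simp add: suminf_ennreal2)
  finally have "AE \<omega> in M. (\<Sum>t. ennreal ((Y t \<omega>)\<^sup>2)) \<noteq> \<infinity>"
    by (intro nn_integral_noteq_infinite) auto
  then show ?thesis
  proof eventually_elim
    case (elim \<omega>)
    then have "summable (\<lambda>t. (Y t \<omega>)\<^sup>2)"
      by (intro summable_suminf_not_top) auto
    then have "(\<lambda>t. (Y t \<omega>)\<^sup>2) \<longlonglongrightarrow> 0" by (rule summable_LIMSEQ_zero)
    from tendsto_real_sqrt[OF this] show "(\<lambda>t. Y t \<omega>) \<longlonglongrightarrow> 0"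
      by (simp add: tendsto_rabs_zero_iff)
  qed
qed

text \<open>By independence the cross terms of the squared sum have mean \<open>0\<close>, so the average of \<open>\<theta> t\<close> variables
  has variance \<open>v / \<theta> t\<close>. Along sizes of order \<open>t powr (1 + e)\<close> these variances are summable.\<close>

lemma (in prob_space) AE_tendsto_average_along_superlinear_sizes:
  fixes X :: "nat \<Rightarrow> 'a \<Rightarrow> real" and \<theta> :: "nat \<Rightarrow> nat"
  assumes indep: "indep_vars (\<lambda>_. borel) X {1..}"
    and int: "\<And>i. i \<ge> 1 \<Longrightarrow> integrable M (X i)"
    and int2: "\<And>i. i \<ge> 1 \<Longrightarrow> integrable M (\<lambda>\<omega>. (X i \<omega>)\<^sup>2)"
    and mean: "\<And>i. i \<ge> 1 \<Longrightarrow> expectation (X i) = 0"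
    and var: "\<And>i. i \<ge> 1 \<Longrightarrow> expectation (\<lambda>\<omega>. (X i \<omega>)\<^sup>2) = v"
    and e: "e > 0" and \<theta>: "\<And>t. t \<ge> 1 \<Longrightarrow> real t powr (1 + e) \<le> real (\<theta> t)"
  shows "AE \<omega> in M. (\<lambda>t. (1 / real (\<theta> t)) * (\<Sum>i=1..\<theta> t. X i \<omega>)) \<longlonglongrightarrow> 0"
proof (rule AE_tendsto_0_if_summable_second_moments)
  have sq: "((1 / real (\<theta> t)) * s)\<^sup>2 = (1 / real (\<theta> t))\<^sup>2 * s\<^sup>2" for t s
    by (rule power_mult_distrib)
  have moment: "integrable M (\<lambda>\<omega>. (\<Sum>i=1..k. X i \<omega>)\<^sup>2) \<and>
      expectation (\<lambda>\<omega>. (\<Sum>i=1..k. X i \<omega>)\<^sup>2) = real k * v" for k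
    using second_moment_sum_indep[of "{1..k}" X] indep_vars_subset[OF indep, of "{1..k}"]
      int int2 mean var by auto
  then show "integrable M (\<lambda>\<omega>. ((1 / real (\<theta> t)) * (\<Sum>i=1..\<theta> t. X i \<omega>))\<^sup>2)" for t
    unfolding sq by simp
  have E: "expectation (\<lambda>\<omega>. ((1 / real (\<theta> t)) * (\<Sum>i=1..\<theta> t. X i \<omega>))\<^sup>2) = v / real (\<theta> t)" for t
    unfolding sq using moment[of "\<theta> t"] by (simp add: power2_eq_square)
  have v: "v \<ge> 0" using var[of 1] by (metis Bochner_Integration.integral_nonneg zero_le_power2 le_refl)
  have "summable (\<lambda>t. v * real t powr (- (1 + e)))"
    using e by (intro summable_mult) (simp add: summable_real_powr_iff)
  moreover have "norm (v / real (\<theta> t)) \<le> v * real t powr (- (1 + e))" if "t \<ge> 1" for t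
  proof -
    have "0 < real t powr (1 + e)" using that by simp
    with \<theta>[OF that] v have "v / real (\<theta> t) \<le> v / real t powr (1 + e)"
      by (intro divide_left_mono mult_pos_pos) linarith+
    then show ?thesis using v unfolding powr_minus by (simp add: divide_inverse)
  qed
  ultimately show "summable (\<lambda>t. expectation (\<lambda>\<omega>. ((1 / real (\<theta> t)) * (\<Sum>i=1..\<theta> t. X i \<omega>))\<^sup>2))"
    unfolding E by (rule summable_comparison_test'[where N = 1])
qed

text \<open>Lets one argument cover both sampling rates: the variances of the averages are summable already
  at the slower rate.\<close>

lemma sample_size_ge:
  assumes "t \<ge> 1"
  shows "real t powr (1 + e) \<le> real (sample_size e \<pi> t)"
proof -
  have "real t powr (1 + e) \<le> real t powr (2 + e)" (is "?a \<le> ?b")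
    using assms by (intro powr_mono) auto
  from order_trans[OF this real_nat_ceiling_ge] real_nat_ceiling_ge[of ?a] show ?thesis
    unfolding sample_size_def by (split if_split) blast
qed

lemma (in prob_space) AE_tendsto_sample_mean:
  fixes Ms :: "nat \<Rightarrow> 'a \<Rightarrow> real^'n^'n"
  assumes indep: "indep_vars (\<lambda>_. borel) Ms {1..}"
    and distr: "\<And>i. i \<ge> 1 \<Longrightarrow> distr M borel (Ms i) = \<pi>"
    and fin: "finite_mean_variance \<pi>" and e: "e > 0"
  shows "AE \<omega> in M. \<forall>i j. (\<lambda>t. sample_mean (\<lambda>k. Ms k \<omega>) (sample_size e \<pi> t) $ i $ j)
    \<longlonglongrightarrow> mean_matrix \<pi> $ i $ j"
proof -
  have meas: "Ms k \<in> borel_measurable M" if "k \<ge> 1" for k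
    using indep that by (auto simp: indep_vars_def)
  have entry: "(\<lambda>A :: real^'n^'n. A $ i $ j) \<in> borel_measurable borel" for i j
    by (intro borel_measurable_continuous_onI continuous_intros)
  have "AE \<omega> in M. (\<lambda>t. sample_mean (\<lambda>k. Ms k \<omega>) (sample_size e \<pi> t) $ i $ j)
    \<longlonglongrightarrow> mean_matrix \<pi> $ i $ j" for i j
  proof -
    let ?m = "mean_matrix \<pi> $ i $ j"
    let ?\<theta> = "sample_size e \<pi>"
    define X where [abs_def]: "X k \<omega> = Ms k \<omega> $ i $ j - ?m" for k \<omega>
    interpret \<pi>: prob_space \<pi>
      using prob_space_distr[OF meas[of 1]] distr[of 1] by simp
    have \<pi>_int: "integrable \<pi> (\<lambda>A. A $ i $ j)" "integrable \<pi> (\<lambda>A. (A $ i $ j - ?m)\<^sup>2)"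
      and \<pi>_mean: "(\<integral>A. A $ i $ j \<partial>\<pi>) = ?m"
      using fin by (auto simp: finite_mean_variance_def mean_matrix_def)
    have push: "integrable M (\<lambda>\<omega>. f (Ms k \<omega>)) \<longleftrightarrow> integrable \<pi> f"
        "expectation (\<lambda>\<omega>. f (Ms k \<omega>)) = (\<integral>A. f A \<partial>\<pi>)"
      if "k \<ge> 1" "f \<in> borel_measurable borel" for k and f :: "real^'n^'n \<Rightarrow> real"
      using integrable_distr_eq[OF meas[OF that(1)] that(2)] integral_distr[OF meas[OF that(1)] that(2)]
        distr[OF that(1)] by simp_all
    have ind: "indep_vars (\<lambda>_. borel) X {1..}"
      unfolding X_def
      by (rule indep_vars_compose2[OF indep, where Y = "\<lambda>_ A. A $ i $ j - ?m"]) (use entry in measurable)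
    have int: "integrable M (X k)" and mean: "expectation (X k) = 0" if "k \<ge> 1" for k
      using push[OF that, of "\<lambda>A. A $ i $ j - ?m"] entry[of i j] \<pi>_int(1) \<pi>_mean \<pi>.prob_space
      by (simp_all add: X_def)
    have int2: "integrable M (\<lambda>\<omega>. (X k \<omega>)\<^sup>2)"
      and var: "expectation (\<lambda>\<omega>. (X k \<omega>)\<^sup>2) = (\<integral>A. (A $ i $ j - ?m)\<^sup>2 \<partial>\<pi>)" if "k \<ge> 1" for k
      using push[OF that, of "\<lambda>A. (A $ i $ j - ?m)\<^sup>2"] entry[of i j] \<pi>_int(2)
      by (simp_all add: X_def)
    from ind int int2 mean var have "AE \<omega> in M. (\<lambda>t. (1 / real (?\<theta> t)) * (\<Sum>k=1..?\<theta> t. X k \<omega>)) \<longlonglongrightarrow> 0"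
      using e sample_size_ge[where e = e and \<pi> = \<pi>]
      by (rule AE_tendsto_average_along_superlinear_sizes[where X = X and \<theta> = ?\<theta>])
    then show ?thesis
    proof eventually_elim
      case (elim \<omega>)
      have eq: "(1 / real (?\<theta> t)) * (\<Sum>k=1..?\<theta> t. X k \<omega>)
          = sample_mean (\<lambda>k. Ms k \<omega>) (?\<theta> t) $ i $ j - ?m" if "t \<ge> 1" for t
      proof -
        have "0 < real t powr (1 + e)" using that by simp
        also have "\<dots> \<le> real (?\<theta> t)" using that by (rule sample_size_ge)
        finally have "real (?\<theta> t) \<noteq> 0" by linarith
        then show ?thesis
          by (simp add: X_def sample_mean_def sum_subtractf diff_divide_distrib)
      qed
      have "\<forall>\<^sub>F t in sequentially. (1 / real (?\<theta> t)) * (\<Sum>k=1..?\<theta> t. X k \<omega>)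
          = sample_mean (\<lambda>k. Ms k \<omega>) (?\<theta> t) $ i $ j - ?m"
        using eventually_ge_at_top[of 1] by eventually_elim (rule eq)
      with elim have "(\<lambda>t. sample_mean (\<lambda>k. Ms k \<omega>) (?\<theta> t) $ i $ j - ?m) \<longlonglongrightarrow> 0"
        by (rule Lim_transform_eventually)
      then show ?case by (simp add: LIM_zero_iff)
    qed
  qed
  then show ?thesis unfolding AE_all_countable by blast
qed

section \<open>Gradients of smooth functions\<close>

lemma GDERIV_grad:
  fixes f :: "real^'n \<Rightarrow> real"
  assumes "f differentiable (at x)"
  shows "GDERIV f x :> grad f x"
proof -
  obtain f' where f': "(f has_derivative f') (at x)"
    using assms by (auto simp: differentiable_def)
  then have "linear f'" by (metis has_derivative_linear)
  from adjoint_works[OF this, of _ 1] have "f' = (\<lambda>v. v \<bullet> adjoint f' 1)"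
    by (simp add: fun_eq_iff)
  with f' have "GDERIV f x :> adjoint f' 1" by (simp add: gderiv_def)
  moreover have "D = E" if "GDERIV f x :> D" "GDERIV f x :> E" for D E
    using has_derivative_unique[OF that[unfolded gderiv_def]]
    by (metis vector_eq_ldot)
  ultimately show ?thesis
    unfolding grad_def by (metis theI)
qed

lemma twice_cont_diff_has_derivative:
  assumes "twice_cont_diff f"
  shows "(f has_derivative (\<lambda>v. v \<bullet> grad f x)) (at x)"
  using GDERIV_grad[of f x] assms by (simp add: twice_cont_diff_def gderiv_def)

text \<open>A bounded set lies in a ball, where the Hessian is bounded by compactness. The remainder
  estimate is the mean value inequality for \<open>f w - grad f v \<bullet> w\<close>, whose gradient \<open>grad f w - grad f v\<close> is
  at most \<open>L\<close> times the length of the segment. This loses a factor two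
  against Taylor's formula, but below only the finiteness of \<open>L\<close> matters.\<close>

lemma twice_cont_diff_lipschitz_on_bounded:
  fixes f :: "real^'n \<Rightarrow> real"
  assumes f: "twice_cont_diff f" and "bounded S"
  obtains L where "L \<ge> 0"
    and "\<And>u v. u \<in> S \<Longrightarrow> v \<in> S \<Longrightarrow> norm (grad f u - grad f v) \<le> L * norm (u - v)"
    and "\<And>u v. u \<in> S \<Longrightarrow> v \<in> S \<Longrightarrow>
      \<bar>f u - f v - grad f v \<bullet> (u - v)\<bar> \<le> L * (norm (u - v))\<^sup>2"
proof -
  obtain R where R: "S \<subseteq> cball 0 R"
    using \<open>bounded S\<close> unfolding bounded_pos by (metis mem_cball_0 subsetI)
  obtain H :: "real^'n \<Rightarrow> real^'n^'n" where H: "continuous_on UNIV H"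
    and dH: "\<And>x. (grad f has_derivative (\<lambda>v. H x *v v)) (at x)"
    using f by (auto simp: twice_cont_diff_def)
  have "compact (H ` cball 0 R)"
    using H by (intro compact_continuous_image) (auto intro: continuous_on_subset)
  then obtain B where B: "B > 0" "\<And>w. w \<in> cball 0 R \<Longrightarrow> norm (H w) \<le> B"
    using compact_imp_bounded[of "H ` cball 0 R"] by (auto simp: bounded_pos)
  define L where "L = real CARD('n) * real CARD('n) * B"
  have L: "L \<ge> 0" using B(1) by (simp add: L_def)
  have onorm_H: "onorm ((*v) (H w)) \<le> L" if "w \<in> cball 0 R" for w
    unfolding L_def
  proof (rule onorm_le_matrix_component)
    fix i j
    have "\<bar>H w $ i $ j\<bar> \<le> norm (H w $ i)" by (rule component_le_norm_cart)
    also have "\<dots> \<le> norm (H w)" by (rule Finite_Cartesian_Product.norm_nth_le)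
    finally show "\<bar>H w $ i $ j\<bar> \<le> B" using B(2)[OF that] by linarith
  qed
  have lip: "norm (grad f u - grad f v) \<le> L * norm (u - v)"
    if "u \<in> cball 0 R" "v \<in> cball 0 R" for u v
    by (rule differentiable_bound[where f' = "\<lambda>w. (*v) (H w)", OF convex_cball[of 0 R]])
      (use that onorm_H dH has_derivative_at_withinI in blast)+
  have remainder: "\<bar>f u - f v - grad f v \<bullet> (u - v)\<bar> \<le> L * (norm (u - v))\<^sup>2"
    if uv: "u \<in> cball 0 R" "v \<in> cball 0 R" for u v
  proof -
    define F where "F w = f w - grad f v \<bullet> w" for w
    have "norm (F u - F v) \<le> (L * norm (u - v)) * norm (u - v)"
    proof (rule differentiable_bound[where f' = "\<lambda>w k. k \<bullet> (grad f w - grad f v)",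
          OF convex_closed_segment])
      fix w assume w: "w \<in> closed_segment v u"
      have "(F has_derivative (\<lambda>k. k \<bullet> grad f w - grad f v \<bullet> k)) (at w within closed_segment v u)"
        unfolding F_def
        by (intro has_derivative_diff has_derivative_inner_right has_derivative_ident
            has_derivative_at_withinI[OF twice_cont_diff_has_derivative[OF f]])
      then show "(F has_derivative (\<lambda>k. k \<bullet> (grad f w - grad f v)))
          (at w within closed_segment v u)"
        by (simp add: inner_diff_right inner_commute)
      have "closed_segment v u \<subseteq> cball 0 R"
        using uv by (simp add: closed_segment_subset)
      with w have "norm (grad f w - grad f v) \<le> L * norm (w - v)"
        using lip uv(2) by blast
      also have "\<dots> \<le> L * norm (u - v)"
        using segment_bound(1)[OF w] L by (intro mult_left_mono) auto
      finally have g: "norm (grad f w - grad f v) \<le> L * norm (u - v)" .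
      show "onorm (\<lambda>k. k \<bullet> (grad f w - grad f v)) \<le> L * norm (u - v)"
      proof (rule onorm_bound)
        fix k
        have "norm (k \<bullet> (grad f w - grad f v)) \<le> norm k * norm (grad f w - grad f v)"
          by (simp add: Cauchy_Schwarz_ineq2)
        also have "\<dots> \<le> norm k * (L * norm (u - v))" using g by (intro mult_left_mono) auto
        finally show "norm (k \<bullet> (grad f w - grad f v)) \<le> L * norm (u - v) * norm k"
          by (simp add: mult.commute)
      qed (use L in simp)
    qed simp_all
    moreover have "F u - F v = f u - f v - grad f v \<bullet> (u - v)"
      by (simp add: F_def inner_diff_right)
    ultimately show ?thesis by (simp add: power2_eq_square mult.assoc)
  qed
  show ?thesis
    using R by (intro that[OF L] lip remainder) auto
qed

section \<open>Descent of the subproblem objective\<close>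

text \<open>The second-order expansion of the subproblem objective around a critical point \<open>u\<close>. It is exact
  because everything but \<open>h\<close> and \<open>\<phi>\<close> is quadratic: the linear terms cancel by stationarity and leave
  the Bregman remainders of \<open>h\<close> and \<open>\<phi>\<close> at \<open>u\<close> and the quadratic term of the penalty.\<close>

lemma isad_obj_diff_at_critical_point:
  fixes h \<phi> :: "real^'n \<Rightarrow> real"
  assumes h: "twice_cont_diff h" and \<phi>: "twice_cont_diff \<phi>"
    and crit: "GDERIV (isad_obj h \<phi> A b xt yn zt) u :> 0"
  shows "isad_obj h \<phi> A b xt yn zt xt - isad_obj h \<phi> A b xt yn zt u =
    (h xt - h u - grad h u \<bullet> (xt - u)) + b / 2 * (norm (A *v (xt - u)))\<^sup>2
    + (\<phi> xt - \<phi> u - grad \<phi> u \<bullet> (xt - u))"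
proof -
  define d where "d = xt - u"
  have lin: "((\<lambda>w. A *v w) has_derivative (\<lambda>w. A *v w)) (at u)"
    by (rule bounded_linear_imp_has_derivative) simp
  have "(isad_obj h \<phi> A b xt yn zt has_derivative
      (\<lambda>k. k \<bullet> grad h u - zt \<bullet> (A *v k)
        + b / 2 * ((A *v u - yn) \<bullet> (A *v k) + (A *v k) \<bullet> (A *v u - yn))
        + (k \<bullet> grad \<phi> u - grad \<phi> xt \<bullet> k))) (at u)"
    unfolding isad_obj_def bregman_def power2_norm_eq_inner
    by (rule has_derivative_eq_rhs)
      (rule derivative_eq_intros lin twice_cont_diff_has_derivative[OF h]
        twice_cont_diff_has_derivative[OF \<phi>] refl | simp)+
  from has_derivative_unique[OF this crit[unfolded gderiv_def]]
  have "d \<bullet> grad h u - zt \<bullet> (A *v d)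
        + b / 2 * ((A *v u - yn) \<bullet> (A *v d) + (A *v d) \<bullet> (A *v u - yn))
        + (d \<bullet> grad \<phi> u - grad \<phi> xt \<bullet> d) = 0"
    by (metis inner_zero_right)
  then have stat: "grad h u \<bullet> d - zt \<bullet> (A *v d) + b * ((A *v d) \<bullet> (A *v u - yn))
        + grad \<phi> u \<bullet> d - grad \<phi> xt \<bullet> d = 0"
    by (simp add: inner_commute)
  have xt: "xt = u + d" by (simp add: d_def)
  have Axt: "A *v xt = A *v u + A *v d" unfolding xt by (rule matrix_vector_right_distrib)
  have quad: "(norm (A *v xt - yn))\<^sup>2 = (norm (A *v u - yn))\<^sup>2
      + 2 * ((A *v d) \<bullet> (A *v u - yn)) + (norm (A *v d))\<^sup>2"
    unfolding Axt power2_norm_eq_inner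
    by (simp add: inner_add_left inner_add_right inner_diff_left inner_diff_right inner_commute)
  have "b / 2 * (norm (A *v xt - yn))\<^sup>2 = b / 2 * (norm (A *v u - yn))\<^sup>2
      + b * ((A *v d) \<bullet> (A *v u - yn)) + b / 2 * (norm (A *v d))\<^sup>2"
    unfolding quad by (simp add: algebra_simps)
  moreover have "zt \<bullet> (A *v xt) = zt \<bullet> (A *v u) + zt \<bullet> (A *v d)"
    unfolding Axt by (rule inner_add_right)
  moreover have "grad \<phi> xt \<bullet> (u - xt) = - (grad \<phi> xt \<bullet> d)"
    by (simp add: d_def inner_diff_right)
  moreover have "grad \<phi> xt \<bullet> (xt - xt) = 0"
    by simp
  ultimately show ?thesis
    using stat unfolding isad_obj_def bregman_def d_def[symmetric] by linarith
qed

section \<open>Stabilisation of the penalties\<close>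

text \<open>Either some late member exceeds \<open>B\<close>, and the sequence is frozen from there on; or the sequence is
  bounded, hence convergent, whereas every doubling is a jump of at least \<open>b 0\<close>.\<close>

lemma doubling_eventually_const:
  fixes b :: "nat \<Rightarrow> real"
  assumes pos: "b 0 > 0"
    and step: "\<And>t. b (Suc t) = b t \<or> b (Suc t) = 2 * b t"
    and large: "\<And>t. t \<ge> T \<Longrightarrow> b t > B \<Longrightarrow> b (Suc t) = b t"
  shows "\<exists>K. \<forall>k\<ge>K. b k = b K"
proof -
  have ge: "b t \<ge> b 0" for t
  proof (induction t)
    case (Suc t)
    with step[of t] pos show ?case by auto
  qed simp
  then have pos': "b t > 0" for t using pos by (metis less_le_trans)
  have inc: "incseq b"
    using step pos' by (intro incseq_SucI) (metis less_imp_le mult_2 add_increasing order_refl)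
  have const: "\<exists>K. \<forall>k\<ge>K. b k = b K" if "\<And>k. k \<ge> K \<Longrightarrow> b (Suc k) = b k" for K
  proof (intro exI allI impI)
    fix k assume "K \<le> k"
    then show "b k = b K" by (induction k rule: dec_induct) (use that in auto)
  qed
  show ?thesis
  proof (cases "\<exists>t\<ge>T. b t > B")
    case True
    then obtain t where "t \<ge> T" "b t > B" by blast
    then have "b (Suc k) = b k" if "k \<ge> t" for k
      using large[of k] incseqD[OF inc that] that by auto
    then show ?thesis by (rule const)
  next
    case False
    then have "b t \<le> B" for t
      using incseqD[OF inc, of t "max t T"] by (metis max.cobounded1 max.cobounded2 not_le order_trans)
    then obtain l where l: "b \<longlonglongrightarrow> l"
      using incseq_convergent[OF inc] by blast
    from tendsto_diff[OF LIMSEQ_Suc[OF l] l] have "(\<lambda>t. b (Suc t) - b t) \<longlonglongrightarrow> 0" by simp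
    from order_tendstoD(2)[OF this pos] obtain K where K: "\<And>k. k \<ge> K \<Longrightarrow> b (Suc k) - b k < b 0"
      by (auto simp: eventually_sequentially)
    have "b (Suc k) = b k" if "k \<ge> K" for k
      using step[of k] K[OF that] ge[of k] by linarith
    then show ?thesis by (rule const)
  qed
qed

lemma emp_lipschitz_power2_le:
  assumes "Z \<ge> 0"
    and "\<And>t. x (Suc t) \<noteq> x t \<Longrightarrow>
      (norm (F (x (Suc t)) - F (x t)))\<^sup>2 / (norm (x (Suc t) - x t))\<^sup>2 \<le> Z"
  shows "(emp_lipschitz F x)\<^sup>2 \<le> ereal Z"
proof -
  let ?q = "\<lambda>t. norm (F (x (Suc t)) - F (x t)) / norm (x (Suc t) - x t)"
  have le: "emp_lipschitz F x \<le> ereal (sqrt Z)"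
    unfolding emp_lipschitz_def
    using assms by (auto intro!: SUP_least real_le_rsqrt simp: power_divide)
  have ge: "0 \<le> emp_lipschitz F x"
  proof (cases "\<forall>t. x (Suc t) = x t")
    case False
    then obtain t where t: "x (Suc t) \<noteq> x t" by blast
    have "0 \<le> ereal (?q t)" by simp
    also have "\<dots> \<le> (SUP t\<in>{t. x (Suc t) \<noteq> x t}. ereal (?q t))"
      using t by (intro SUP_upper) simp
    finally show ?thesis using False by (simp add: emp_lipschitz_def)
  qed (simp add: emp_lipschitz_def)
  have "(emp_lipschitz F x)\<^sup>2 \<le> (ereal (sqrt Z))\<^sup>2"
    unfolding power2_eq_square by (rule ereal_mult_mono[OF order_trans[OF ge le] ge le le])
  also have "\<dots> = ereal Z" using \<open>Z \<ge> 0\<close> by simp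
  finally show ?thesis .
qed


lemma general_apo_step:
  assumes apo: "general_apo \<epsilon> h \<phi> A x y z \<beta> \<zeta> \<xi>"
  shows "\<beta> (Suc t) = \<beta> t \<or> \<beta> (Suc t) = 2 * \<beta> t"
    and "x (Suc t) = x t \<Longrightarrow> \<beta> (Suc t) = \<beta> t"
    and "x (Suc t) \<noteq> x t \<Longrightarrow> lambda_min (transpose (A (Suc t)) ** A (Suc t)) \<noteq> 0 \<Longrightarrow>
      \<beta> (Suc t) = (if
        1 / 4 * (- (2 * (isad_g h \<phi> A x y z \<beta> t (x (Suc t)) - isad_g h \<phi> A x y z \<beta> t (x t))
          / (norm (x (Suc t) - x t))\<^sup>2))
        > 8 * (\<zeta> (Suc t) + \<xi> (Suc t) + \<epsilon>)
          / (\<beta> t * lambda_min (transpose (A (Suc t)) ** A (Suc t)))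
        then \<beta> t else 2 * \<beta> t)"
  using apo unfolding general_apo_def Let_def by (metis+)

lemma general_apo_pos:
  assumes apo: "general_apo \<epsilon> h \<phi> A x y z \<beta> \<zeta> \<xi>" and "\<beta> 0 > 0"
  shows "\<beta> t > 0"
proof (induction t)
  case (Suc t)
  then show ?case using general_apo_step(1)[OF apo, of t] by auto
qed (rule assms(2))

text \<open>The updates of \<open>\<zeta>\<close> and \<open>\<xi>\<close> as running maxima of the squared difference quotients of the two
  maps whose empirical Lipschitz constants occur in the requirements.\<close>

lemma general_apo_running_max:
  assumes apo: "general_apo \<epsilon> h \<phi> A x y z \<beta> \<zeta> \<xi>"
  shows "\<zeta> 0 = 0" and "\<xi> 0 = 0"
    and "\<zeta> (Suc t) = (if x (Suc t) = x t then \<zeta> t else max (\<zeta> t)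
      ((norm ((grad h (x (Suc t)) + grad \<phi> (x (Suc t))) - (grad h (x t) + grad \<phi> (x t))))\<^sup>2
        / (norm (x (Suc t) - x t))\<^sup>2))"
    and "\<xi> (Suc t) = (if x (Suc t) = x t then \<xi> t else max (\<xi> t)
      ((norm (grad \<phi> (x (Suc t)) - grad \<phi> (x t)))\<^sup>2 / (norm (x (Suc t) - x t))\<^sup>2))"
proof -
  show "\<zeta> 0 = 0" "\<xi> 0 = 0"
    using apo by (simp_all add: general_apo_def)
  note step = apo[unfolded general_apo_def Let_def, THEN conjunct2, THEN conjunct2, THEN spec, of t]
  show "\<zeta> (Suc t) = (if x (Suc t) = x t then \<zeta> t else max (\<zeta> t)
      ((norm ((grad h (x (Suc t)) + grad \<phi> (x (Suc t))) - (grad h (x t) + grad \<phi> (x t))))\<^sup>2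
        / (norm (x (Suc t) - x t))\<^sup>2))"
    using step by (cases "x (Suc t) = x t")
      (simp_all only: if_True if_False refl simp_thms diff_diff_eq)
  show "\<xi> (Suc t) = (if x (Suc t) = x t then \<xi> t else max (\<xi> t)
      ((norm (grad \<phi> (x (Suc t)) - grad \<phi> (x t)))\<^sup>2 / (norm (x (Suc t) - x t))\<^sup>2))"
    using step by (cases "x (Suc t) = x t") (simp_all only: if_True if_False refl simp_thms)
qed

text \<open>The limit of a running maximum dominates all values that entered it; \<open>s t\<close> marks the steps
  that are skipped.\<close>

lemma running_max_converges:
  fixes c :: "nat \<Rightarrow> real"
  assumes "c 0 = 0"
    and step: "\<And>t. c (Suc t) = (if s t then c t else max (c t) (q t))"
    and bound: "\<And>t. \<not> s t \<Longrightarrow> q t \<le> C" and "0 \<le> C"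
  obtains Z where "c \<longlonglongrightarrow> Z" and "\<And>t. c t \<le> C" and "0 \<le> Z" and "\<And>t. \<not> s t \<Longrightarrow> q t \<le> Z"
proof -
  have inc: "incseq c" by (rule incseq_SucI) (simp add: step)
  have le: "c t \<le> C" for t
    by (induction t) (use assms in auto)
  obtain Z where Z: "c \<longlonglongrightarrow> Z" "\<And>t. c t \<le> Z"
    using incseq_convergent[OF inc] le by blast
  show ?thesis
  proof (rule that[OF Z(1) le])
    show "0 \<le> Z" using Z(2)[of 0] assms(1) by simp
    show "q t \<le> Z" if "\<not> s t" for t
      using Z(2)[of "Suc t"] that by (simp add: step)
  qed
qed

text \<open>The requirements on one sample path. Stabilisation combines the descent estimate with the upper
  bounds for \<open>\<zeta>\<close> and \<open>\<xi>\<close>; the constant \<open>\<rho>\<close> is then read off from the test that all later steps pass.\<close>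

lemma apo_eventually_stable:
  fixes h \<phi> :: "real^'n \<Rightarrow> real"
  assumes h: "twice_cont_diff h" and \<phi>: "twice_cont_diff \<phi>"
    and crit: "\<And>t. GDERIV (isad_g h \<phi> A x y z \<beta> t) (x (Suc t)) :> 0"
    and apo: "general_apo \<epsilon> h \<phi> A x y z \<beta> \<zeta> \<xi>"
    and \<beta>0: "\<beta> 0 > 0" and \<epsilon>: "\<epsilon> > 0"
    and bdd: "bounded (range x)"
    and lam: "(\<lambda>t. lambda_min (transpose (A t) ** A t)) \<longlonglongrightarrow> \<sigma>" and \<sigma>: "\<sigma> > 0"
  shows "\<exists>K>0. (\<forall>k>K. \<beta> k = \<beta> K) \<and>
    (\<exists>\<rho>>0. \<forall>k>K.
      isad_g h \<phi> A x y z \<beta> k (x (Suc k)) - isad_g h \<phi> A x y z \<beta> k (x k)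
        \<le> - (\<rho> / 2) * (norm (x (Suc k) - x k))\<^sup>2 \<and>
      ereal \<rho> > ereal (8 / (\<beta> k * \<sigma>)) *
        ((emp_lipschitz (\<lambda>v. grad h v + grad \<phi> v) x)\<^sup>2 + (emp_lipschitz (grad \<phi>) x)\<^sup>2))"
proof -
  define \<Lambda> where "\<Lambda> t = lambda_min (transpose (A t) ** A t)" for t
  define \<Delta> where "\<Delta> t = isad_g h \<phi> A x y z \<beta> t (x (Suc t)) - isad_g h \<phi> A x y z \<beta> t (x t)" for t
  define d where "d t = norm (x (Suc t) - x t)" for t
  obtain Lh where Lh: "Lh \<ge> 0"
    "\<And>s t. norm (grad h (x s) - grad h (x t)) \<le> Lh * norm (x s - x t)"
    "\<And>s t. \<bar>h (x s) - h (x t) - grad h (x t) \<bullet> (x s - x t)\<bar> \<le> Lh * (norm (x s - x t))\<^sup>2"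
    using twice_cont_diff_lipschitz_on_bounded[OF h bdd] by (metis rangeI)
  obtain L\<phi> where L\<phi>: "L\<phi> \<ge> 0"
    "\<And>s t. norm (grad \<phi> (x s) - grad \<phi> (x t)) \<le> L\<phi> * norm (x s - x t)"
    "\<And>s t. \<bar>\<phi> (x s) - \<phi> (x t) - grad \<phi> (x t) \<bullet> (x s - x t)\<bar> \<le> L\<phi> * (norm (x s - x t))\<^sup>2"
    using twice_cont_diff_lipschitz_on_bounded[OF \<phi> bdd] by (metis rangeI)
  define L where "L = Lh + L\<phi>"
  have L: "L \<ge> 0" using Lh(1) L\<phi>(1) by (simp add: L_def)
  have \<Lambda>: "\<forall>\<^sub>F t in sequentially. \<sigma> / 2 < \<Lambda> (Suc t) \<and> \<Lambda> (Suc t) < 2 * \<sigma>"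
  proof -
    have "(\<lambda>t. \<Lambda> (Suc t)) \<longlonglongrightarrow> \<sigma>"
      using LIMSEQ_Suc[OF lam] by (simp add: \<Lambda>_def)
    then show ?thesis
      using \<sigma> by (intro eventually_conj order_tendstoD) auto
  qed
  then obtain T where T: "\<And>t. t \<ge> T \<Longrightarrow> \<sigma> / 2 < \<Lambda> (Suc t)" "\<And>t. t \<ge> T \<Longrightarrow> \<Lambda> (Suc t) < 2 * \<sigma>"
    unfolding eventually_sequentially by blast
  have quot: "n\<^sup>2 / m\<^sup>2 \<le> c\<^sup>2" if "n \<le> c * m" "0 \<le> n" "0 < m" for n m c :: real
    using power_mono[OF that(1,2), of 2] that(3) by (simp add: power_mult_distrib field_simps)
  have quot_h\<phi>: "(norm ((grad h (x (Suc t)) + grad \<phi> (x (Suc t))) - (grad h (x t) + grad \<phi> (x t))))\<^sup>2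
        / (norm (x (Suc t) - x t))\<^sup>2 \<le> L\<^sup>2" if "x (Suc t) \<noteq> x t" for t
  proof (rule quot)
    have "norm ((grad h (x (Suc t)) + grad \<phi> (x (Suc t))) - (grad h (x t) + grad \<phi> (x t)))
      \<le> norm (grad h (x (Suc t)) - grad h (x t)) + norm (grad \<phi> (x (Suc t)) - grad \<phi> (x t))"
      by (metis add_diff_add norm_triangle_ineq)
    with Lh(2)[of "Suc t" t] L\<phi>(2)[of "Suc t" t]
    show "norm ((grad h (x (Suc t)) + grad \<phi> (x (Suc t))) - (grad h (x t) + grad \<phi> (x t)))
      \<le> L * norm (x (Suc t) - x t)"
      unfolding L_def distrib_right by linarith
  qed (use that in auto)
  have quot_\<phi>: "(norm (grad \<phi> (x (Suc t)) - grad \<phi> (x t)))\<^sup>2 / (norm (x (Suc t) - x t))\<^sup>2 \<le> L\<phi>\<^sup>2"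
    if "x (Suc t) \<noteq> x t" for t
    by (rule quot) (use that L\<phi>(2) in auto)
  obtain Z where Z: "\<zeta> \<longlonglongrightarrow> Z" "\<And>t. \<zeta> t \<le> L\<^sup>2" "0 \<le> Z"
    and Zq: "\<And>t. x (Suc t) \<noteq> x t \<Longrightarrow>
      (norm ((grad h (x (Suc t)) + grad \<phi> (x (Suc t))) - (grad h (x t) + grad \<phi> (x t))))\<^sup>2
        / (norm (x (Suc t) - x t))\<^sup>2 \<le> Z"
    by (rule running_max_converges[OF general_apo_running_max(1,3)[OF apo] quot_h\<phi> zero_le_power2]) blast+
  obtain X where X: "\<xi> \<longlonglongrightarrow> X" "\<And>t. \<xi> t \<le> L\<phi>\<^sup>2" "0 \<le> X"
    and Xq: "\<And>t. x (Suc t) \<noteq> x t \<Longrightarrow>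
      (norm (grad \<phi> (x (Suc t)) - grad \<phi> (x t)))\<^sup>2 / (norm (x (Suc t) - x t))\<^sup>2 \<le> X"
    by (rule running_max_converges[OF general_apo_running_max(2,4)[OF apo] quot_\<phi> zero_le_power2]) blast+
  note pos = general_apo_pos[OF apo \<beta>0]
  have descent: "\<Delta> t \<le> - (\<beta> t * \<Lambda> (Suc t) / 2 - L) * (d t)\<^sup>2" for t
  proof -
    have "- \<Delta> t = (h (x t) - h (x (Suc t)) - grad h (x (Suc t)) \<bullet> (x t - x (Suc t)))
      + \<beta> t / 2 * (norm (A (Suc t) *v (x t - x (Suc t))))\<^sup>2
      + (\<phi> (x t) - \<phi> (x (Suc t)) - grad \<phi> (x (Suc t)) \<bullet> (x t - x (Suc t)))"
      unfolding \<Delta>_def using isad_obj_diff_at_critical_point[OF h \<phi> crit[of t, unfolded isad_g_def]]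
      by (simp add: isad_g_def)
    moreover have "\<Lambda> (Suc t) * (d t)\<^sup>2 \<le> (norm (A (Suc t) *v (x t - x (Suc t))))\<^sup>2"
      unfolding \<Lambda>_def d_def norm_minus_commute[of "x (Suc t)"] by (metis lambda_min_gram_obtain)
    then have "\<beta> t / 2 * (\<Lambda> (Suc t) * (d t)\<^sup>2)
        \<le> \<beta> t / 2 * (norm (A (Suc t) *v (x t - x (Suc t))))\<^sup>2"
      using pos[of t] by (intro mult_left_mono) auto
    moreover have "h (x t) - h (x (Suc t)) - grad h (x (Suc t)) \<bullet> (x t - x (Suc t)) \<ge> - (Lh * (d t)\<^sup>2)"
      using Lh(3)[of t "Suc t"] unfolding d_def norm_minus_commute[of "x (Suc t)"] by linarith
    moreover have "\<phi> (x t) - \<phi> (x (Suc t)) - grad \<phi> (x (Suc t)) \<bullet> (x t - x (Suc t)) \<ge> - (L\<phi> * (d t)\<^sup>2)"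
      using L\<phi>(3)[of t "Suc t"] unfolding d_def norm_minus_commute[of "x (Suc t)"] by linarith
    ultimately show ?thesis by (simp add: L_def algebra_simps)
  qed
  define C where "C = L\<^sup>2 + L\<phi>\<^sup>2 + \<epsilon>"
  \<comment> \<open>The test passes as soon as \<open>s = \<beta> t * \<Lambda> (Suc t)\<close> is at least \<open>S\<close>: its threshold is
    \<open>8 C / s\<close> at most, and \<open>(s - 2 L) / 4 > 8 C \<ge> 8 C / s\<close>.\<close>
  define S where "S = 2 * L + 32 * C + 1"
  have C: "C \<ge> 0" using \<epsilon> by (simp add: C_def)
  have large: "\<beta> (Suc t) = \<beta> t" if t: "t \<ge> T" "\<beta> t > 2 * S / \<sigma>" for t
  proof (cases "x (Suc t) = x t")
    case False
    define s where "s = \<beta> t * \<Lambda> (Suc t)"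
    have "S = 2 * S / \<sigma> * (\<sigma> / 2)" using \<sigma> by simp
    also have "\<dots> \<le> s"
      unfolding s_def using t(2) T(1)[OF t(1)] \<sigma> pos[of t] by (intro mult_mono) auto
    finally have s: "s \<ge> S" .
    then have s1: "s \<ge> 1" using L C by (simp add: S_def)
    have "8 * (\<zeta> (Suc t) + \<xi> (Suc t) + \<epsilon>) / s \<le> 8 * C / s"
      using Z(2)[of "Suc t"] X(2)[of "Suc t"] s1 by (intro divide_right_mono) (auto simp: C_def)
    also have "\<dots> \<le> 8 * C / 1"
      using C s1 by (intro divide_left_mono) auto
    also have "\<dots> < 1 / 4 * (s - 2 * L)" using s by (simp add: S_def)
    also have "s - 2 * L \<le> - (2 * \<Delta> t / (d t)\<^sup>2)"
      using descent[of t] False by (simp add: s_def d_def field_simps)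
    finally have "8 * (\<zeta> (Suc t) + \<xi> (Suc t) + \<epsilon>) / (\<beta> t * \<Lambda> (Suc t)) < 1 / 4 * (- (2 * \<Delta> t / (d t)\<^sup>2))"
      by (simp add: s_def)
    moreover have "\<Lambda> (Suc t) \<noteq> 0" using T(1)[OF t(1)] \<sigma> by linarith
    ultimately show ?thesis
      using general_apo_step(3)[OF apo False] unfolding \<Lambda>_def \<Delta>_def d_def by simp
  qed (rule general_apo_step(2)[OF apo])
  obtain K0 where K0: "\<And>k. k \<ge> K0 \<Longrightarrow> \<beta> k = \<beta> K0"
    using doubling_eventually_const[OF \<beta>0 general_apo_step(1)[OF apo] large] by blast
  have "(\<lambda>t. \<zeta> (Suc t) + \<xi> (Suc t)) \<longlonglongrightarrow> Z + X"
    by (intro tendsto_add LIMSEQ_Suc Z(1) X(1))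
  from order_tendstoD(1)[OF this, of "Z + X - \<epsilon> / 2"] \<epsilon>
  obtain N where N: "\<And>t. t \<ge> N \<Longrightarrow> Z + X - \<epsilon> / 2 < \<zeta> (Suc t) + \<xi> (Suc t)"
    by (auto simp: eventually_sequentially)
  define K where "K = Suc (max K0 (max T N))"
  define E where "E = Z + X + \<epsilon> / 2"
  \<comment> \<open>With \<open>\<Lambda> (Suc k) < 2 \<sigma>\<close> the threshold of the test is at least \<open>8 E / (2 \<beta> \<sigma>)\<close>, which is \<open>\<rho> / 4\<close>. On
    the other hand \<open>16 E\<close> exceeds \<open>8 (Z + X)\<close>, as the claimed gap requires.\<close>
  define \<rho> where "\<rho> = 16 * E / (\<beta> K * \<sigma>)"
  have E: "E > 0" using Z(3) X(3) \<epsilon> by (simp add: E_def)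
  have const: "\<beta> k = \<beta> K" if "k \<ge> K" for k
    using K0[of k] K0[of K] that by (simp add: K_def)
  have decrease: "\<Delta> k \<le> - (\<rho> / 2) * (d k)\<^sup>2" if "k > K" for k
  proof (cases "x (Suc k) = x k")
    case True
    then show ?thesis by (simp add: \<Delta>_def d_def)
  next
    case False
    have k: "k \<ge> T" "k \<ge> N" using that by (auto simp: K_def)
    have \<Lambda>k: "0 < \<Lambda> (Suc k)" "\<Lambda> (Suc k) < 2 * \<sigma>" using T[OF k(1)] \<sigma> by linarith+
    have "\<beta> (Suc k) = \<beta> k" using const[of k] const[of "Suc k"] that by simp
    then have "1 / 4 * (- (2 * \<Delta> k / (d k)\<^sup>2)) > 8 * (\<zeta> (Suc k) + \<xi> (Suc k) + \<epsilon>) / (\<beta> k * \<Lambda> (Suc k))"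
      using general_apo_step(3)[OF apo False] \<Lambda>k(1) pos[of k]
      unfolding \<Lambda>_def \<Delta>_def d_def by (auto split: if_splits)
    moreover have "8 * (\<zeta> (Suc k) + \<xi> (Suc k) + \<epsilon>) / (\<beta> k * \<Lambda> (Suc k)) \<ge> 8 * E / (\<beta> k * \<Lambda> (Suc k))"
      using N[OF k(2)] \<Lambda>k(1) pos[of k] by (intro divide_right_mono) (auto simp: E_def)
    moreover have "8 * E / (\<beta> k * \<Lambda> (Suc k)) \<ge> 8 * E / (\<beta> k * (2 * \<sigma>))"
      using \<Lambda>k pos[of k] E \<sigma> by (intro divide_left_mono mult_left_mono) auto
    moreover have "8 * E / (\<beta> k * (2 * \<sigma>)) = \<rho> / 4"
      using const[of k] that by (simp add: \<rho>_def)
    ultimately have "\<rho> < - (2 * \<Delta> k / (d k)\<^sup>2)" by linarith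
    moreover have "0 < (d k)\<^sup>2" using False by (simp add: d_def)
    ultimately show ?thesis by (simp add: field_simps)
  qed
  have gap: "ereal \<rho> > ereal (8 / (\<beta> k * \<sigma>)) *
      ((emp_lipschitz (\<lambda>v. grad h v + grad \<phi> v) x)\<^sup>2 + (emp_lipschitz (grad \<phi>) x)\<^sup>2)"
    if "k > K" for k
  proof -
    have b: "\<beta> K * \<sigma> > 0" using pos \<sigma> by simp
    have "(emp_lipschitz (\<lambda>v. grad h v + grad \<phi> v) x)\<^sup>2 + (emp_lipschitz (grad \<phi>) x)\<^sup>2
        \<le> ereal Z + ereal X"
      using emp_lipschitz_power2_le[OF Z(3), of x "\<lambda>v. grad h v + grad \<phi> v"]
        emp_lipschitz_power2_le[OF X(3), of x "grad \<phi>"] Zq Xq by (intro add_mono) auto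
    then have "ereal (8 / (\<beta> k * \<sigma>)) *
      ((emp_lipschitz (\<lambda>v. grad h v + grad \<phi> v) x)\<^sup>2 + (emp_lipschitz (grad \<phi>) x)\<^sup>2)
        \<le> ereal (8 / (\<beta> k * \<sigma>)) * (ereal Z + ereal X)"
      using pos[of k] \<sigma> by (intro ereal_mult_left_mono) auto
    also have "\<dots> = ereal (8 * (Z + X) / (\<beta> K * \<sigma>))"
      using const[of k] that by simp
    also have "8 * (Z + X) / (\<beta> K * \<sigma>) < \<rho>"
      unfolding \<rho>_def using b Z(3) X(3) \<epsilon> by (intro divide_strict_right_mono) (auto simp: E_def)
    finally show ?thesis by simp
  qed
  have "\<rho> > 0" using E pos[of K] \<sigma> by (simp add: \<rho>_def)
  moreover have "K > 0" by (simp add: K_def)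
  moreover have "\<forall>k>K. \<beta> k = \<beta> K" using const less_imp_le by blast
  ultimately show ?thesis
    using decrease gap unfolding \<Delta>_def d_def by blast
qed

section \<open>Almost sure stability of the penalty oracle\<close>

theorem theorem3:
  fixes N :: "'w measure"
    and \<pi> :: "(real^'n^'n) measure"
    and M :: "nat \<Rightarrow> 'w \<Rightarrow> real^'n^'n"
    and h \<phi> :: "real^'n \<Rightarrow> real"
    and P :: "real^'n \<Rightarrow> ereal"
    and x0 z0 :: "real^'n"
    and \<beta>0 \<epsilon> \<epsilon>s \<sigma> :: real
    and x y z :: "nat \<Rightarrow> 'w \<Rightarrow> real^'n"
    and \<beta> \<zeta> \<xi> :: "nat \<Rightarrow> 'w \<Rightarrow> real"
    and Mbar :: "nat \<Rightarrow> 'w \<Rightarrow> real^'n^'n"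
    and g :: "nat \<Rightarrow> 'w \<Rightarrow> real^'n \<Rightarrow> real"
  assumes prob: "prob_space N"
    and indep: "prob_space.indep_vars N (\<lambda>_. borel) M {1..}"
    and distr: "\<And>i. i \<ge> 1 \<Longrightarrow> distr N borel (M i) = \<pi>"
    and finvar: "finite_mean_variance \<pi>"
    and full_rank: "rank (mean_matrix \<pi>) = CARD('n)"
    and \<sigma>_def: "\<sigma> = lambda_min (transpose (mean_matrix \<pi>) ** mean_matrix \<pi>)"
    and h: "twice_cont_diff h"
    and P: "proper P" "lower_semicont P" "prox_tractable P"
    and \<phi>: "twice_cont_diff \<phi>" "convex_on UNIV \<phi>"
    and \<epsilon>s: "\<epsilon>s > 0"
    and \<epsilon>: "\<epsilon> > 0"
    and \<beta>0: "\<beta>0 > 0"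
    and Mbar_def: "\<And>t \<omega>. Mbar t \<omega> = sample_mean (\<lambda>i. M i \<omega>) (sample_size \<epsilon>s \<pi> t)"
    and isad: "\<And>\<omega>. \<omega> \<in> space N \<Longrightarrow>
      meta_isad h P \<phi> (\<lambda>t. Mbar t \<omega>) x0 z0 \<beta>0
        (\<lambda>t. x t \<omega>) (\<lambda>t. y t \<omega>) (\<lambda>t. z t \<omega>) (\<lambda>t. \<beta> t \<omega>)"
    and apo: "\<And>\<omega>. \<omega> \<in> space N \<Longrightarrow>
      general_apo \<epsilon> h \<phi> (\<lambda>t. Mbar t \<omega>)
        (\<lambda>t. x t \<omega>) (\<lambda>t. y t \<omega>) (\<lambda>t. z t \<omega>) (\<lambda>t. \<beta> t \<omega>) (\<lambda>t. \<zeta> t \<omega>) (\<lambda>t. \<xi> t \<omega>)"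
    and bdd: "AE \<omega> in N. bounded ((\<lambda>t. (x t \<omega>, y t \<omega>, z t \<omega>)) ` {0<..})"
    and g_def: "\<And>k \<omega>. g (Suc k) \<omega> =
      isad_g h \<phi> (\<lambda>t. Mbar t \<omega>)
        (\<lambda>t. x t \<omega>) (\<lambda>t. y t \<omega>) (\<lambda>t. z t \<omega>) (\<lambda>t. \<beta> t \<omega>) k"
  shows "(\<forall>\<omega>\<in>space N. \<forall>t. \<beta> t \<omega> > 0) \<and>
    (AE \<omega> in N. \<exists>K>0.
       (\<forall>k>K. \<beta> k \<omega> = \<beta> K \<omega>) \<and>
       (\<exists>\<rho>>0. \<forall>k>K.
          g (Suc k) \<omega> (x (Suc k) \<omega>) - g (Suc k) \<omega> (x k \<omega>)
            \<le> - (\<rho> / 2) * (norm (x (Suc k) \<omega> - x k \<omega>))\<^sup>2 \<and>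
          ereal \<rho> > ereal (8 / (\<beta> k \<omega> * \<sigma>)) *
            ((emp_lipschitz (\<lambda>v. grad h v + grad \<phi> v) (\<lambda>t. x t \<omega>))\<^sup>2 +
             (emp_lipschitz (grad \<phi>) (\<lambda>t. x t \<omega>))\<^sup>2)))"
proof (intro conjI ballI allI)
  fix \<omega> t assume \<omega>: "\<omega> \<in> space N"
  have "\<beta> 0 \<omega> > 0"
    using isad[OF \<omega>] \<beta>0 by (simp add: meta_isad_def)
  then show "\<beta> t \<omega> > 0"
    by (rule general_apo_pos[OF apo[OF \<omega>]])
next
  have \<sigma>: "\<sigma> > 0"
    unfolding \<sigma>_def using full_rank by (intro lambda_min_gram_pos) (simp add: full_rank_injective)
  have "AE \<omega> in N. \<forall>i j. (\<lambda>t. Mbar t \<omega> $ i $ j) \<longlonglongrightarrow> mean_matrix \<pi> $ i $ j"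
    unfolding Mbar_def
    by (rule prob_space.AE_tendsto_sample_mean[OF prob indep distr finvar \<epsilon>s])
  from this bdd AE_space
  show "AE \<omega> in N. \<exists>K>0. (\<forall>k>K. \<beta> k \<omega> = \<beta> K \<omega>) \<and>
       (\<exists>\<rho>>0. \<forall>k>K.
          g (Suc k) \<omega> (x (Suc k) \<omega>) - g (Suc k) \<omega> (x k \<omega>)
            \<le> - (\<rho> / 2) * (norm (x (Suc k) \<omega> - x k \<omega>))\<^sup>2 \<and>
          ereal \<rho> > ereal (8 / (\<beta> k \<omega> * \<sigma>)) *
            ((emp_lipschitz (\<lambda>v. grad h v + grad \<phi> v) (\<lambda>t. x t \<omega>))\<^sup>2 +
             (emp_lipschitz (grad \<phi>) (\<lambda>t. x t \<omega>))\<^sup>2))"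
  proof eventually_elim
    case (elim \<omega>)
    note \<omega> = \<open>\<omega> \<in> space N\<close>
    have lam: "(\<lambda>t. lambda_min (transpose (Mbar t \<omega>) ** Mbar t \<omega>)) \<longlonglongrightarrow> \<sigma>"
      unfolding \<sigma>_def using elim(1) by (intro tendsto_lambda_min_gram) blast
    \<comment> \<open>The boundedness assumption leaves out the index \<open>0\<close>, whose point enters the empirical
      Lipschitz constants.\<close>
    have "range (\<lambda>t. x t \<omega>) \<subseteq> insert (x 0 \<omega>) (fst ` (\<lambda>t. (x t \<omega>, y t \<omega>, z t \<omega>)) ` {0<..})"
    proof
      fix v assume "v \<in> range (\<lambda>t. x t \<omega>)"
      then obtain t where "v = x t \<omega>" by blast
      then show "v \<in> insert (x 0 \<omega>) (fst ` (\<lambda>t. (x t \<omega>, y t \<omega>, z t \<omega>)) ` {0<..})"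
        by (cases t) (auto simp: image_image)
    qed
    then have bounded: "bounded (range (\<lambda>t. x t \<omega>))"
      by (rule bounded_subset[rotated]) (simp only: bounded_insert bounded_fst[OF elim(2)])
    show ?case
      unfolding g_def
    proof (rule apo_eventually_stable[OF h \<phi>(1) _ apo[OF \<omega>] _ \<epsilon> bounded lam \<sigma>])
      show "GDERIV (isad_g h \<phi> (\<lambda>t. Mbar t \<omega>) (\<lambda>t. x t \<omega>) (\<lambda>t. y t \<omega>) (\<lambda>t. z t \<omega>) (\<lambda>t. \<beta> t \<omega>) t)
          (x (Suc t) \<omega>) :> 0" for t
        using isad[OF \<omega>] by (simp add: meta_isad_def)
      show "0 < \<beta> 0 \<omega>"
        using isad[OF \<omega>] \<beta>0 by (simp add: meta_isad_def)
    qed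
  qed
qed

end
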